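(* Let $(G,u)$ be a finitely generated semisimple unital $\ell$-group whose maximal ideals of finite rank are dense in the maximal spectral space $\mu(G,u)$. Then $(G,u)$ is hopfian.
   Context: A unital $\ell$-group $(G,u)$ is an abelian group $G$ with a translation-invariant lattice order and a distinguished unit $u\geq 0$ such that every $0\le x\in G$ is dominated by some integer multiple of $u$. All unital $\ell$-groups are assumed nontrivial. Homomorphisms of unital $\ell$-groups preserve the group structure, the lattice structure and the unit. An ideal of $(G,u)$ is the kernel of a homomorphism; ideals are assumed proper (different from $G$). $\mu(G,u)$ is the set of maximal ideals with the hull-kernel topology: a basis of closed sets is given by the sets $\{\mathfrak m\in\mu(G,u)\mid a\in\mathfrak m\}$, $a\in G$. $(G,u)$ is semisimple if the intersection of its maximal ideals is $\{0\}$. A maximal ideal $\mathfrak m$ has finite rank if $G/\mathfrak m$ is isomorphic to the additive group $\mathbb Z$ with its natural order (the unit being some integer $v>0$). $(G,u)$ is hopfian if every homomorphism (of unital $\ell$-groups) of $(G,u)$ onto $(G,u)$ is an automorphism. *)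

theory Defs
  imports "HOL-Algebra.Coset" "HOL-Algebra.Lattice" "HOL-Analysis.Function_Topology"
begin

text \<open>
  Groups are written multiplicatively, as in HOL-Algebra: \<open>\<otimes>\<close> is the addition, \<open>\<one>\<close> the zero
  and \<open>x [^] n\<close> the integer multiple \<open>n x\<close> of the usual additive notation for
  \<open>\<ell>\<close>-groups.
\<close>

record 'a ulgroup = "'a monoid" +
  leq :: "'a \<Rightarrow> 'a \<Rightarrow> bool"  (infixl \<open>\<preceq>\<index>\<close> 50)
  unt :: 'a  (\<open>\<u>\<index>\<close>)

definition order_of :: "('a, 'm) ulgroup_scheme \<Rightarrow> 'a gorder" where
  "order_of G = \<lparr>carrier = carrier G, eq = (=), le = leq G\<rparr>"

locale unital_lgroup = comm_group G + ord: Lattice.lattice "order_of G" for G (structure) +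
  assumes translation_invariant:
    "\<lbrakk>x \<in> carrier G; y \<in> carrier G; z \<in> carrier G; x \<preceq> y\<rbrakk> \<Longrightarrow> z \<otimes> x \<preceq> z \<otimes> y"
  and unit_closed: "\<u> \<in> carrier G"
  and unit_nonneg: "\<one> \<preceq> \<u>"
  and unit_dominates:
    "\<lbrakk>x \<in> carrier G; \<one> \<preceq> x\<rbrakk> \<Longrightarrow> \<exists>n::int. x \<preceq> \<u> [^] n"
  and nontrivial: "carrier G \<noteq> {\<one>}"

definition ulhom :: "('a, 'm) ulgroup_scheme \<Rightarrow> ('b, 'n) ulgroup_scheme \<Rightarrow> ('a \<Rightarrow> 'b) set" where
  "ulhom G H = {h \<in> hom G H.
     join_pres (order_of G) (order_of H) h \<and> meet_pres (order_of G) (order_of H) h \<and>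
     h \<u>\<^bsub>G\<^esub> = \<u>\<^bsub>H\<^esub>}"

definition uliso :: "('a, 'm) ulgroup_scheme \<Rightarrow> ('b, 'n) ulgroup_scheme \<Rightarrow> ('a \<Rightarrow> 'b) set" where
  "uliso G H = {h \<in> ulhom G H. bij_betw h (carrier G) (carrier H)}"

text \<open>
  The codomains in the next definition range over unital \<open>\<ell>\<close>-groups on the type \<open>'a set\<close>.
  This is no restriction: the lemma \<open>kernel_is_lideal\<close> below shows that the kernel of a
  homomorphism into a unital \<open>\<ell>\<close>-group over any type is an ideal in this sense.  Ideals are
  proper because codomains are nontrivial.
\<close>

definition lideal :: "'a set \<Rightarrow> ('a, 'm) ulgroup_scheme \<Rightarrow> bool" where
  "lideal I G \<longleftrightarrow>
     (\<exists>(H :: 'a set ulgroup) h. unital_lgroup H \<and> h \<in> ulhom G H \<and> I = kernel G H h) \<and>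
     I \<noteq> carrier G"

definition max_lideals :: "('a, 'm) ulgroup_scheme \<Rightarrow> 'a set set" where
  "max_lideals G = {I. lideal I G \<and> (\<forall>J. lideal J G \<longrightarrow> I \<subseteq> J \<longrightarrow> J = I)}"

text \<open>The hull-kernel topology: the basic open sets are the complements of the basic closed sets.\<close>

definition max_spectrum :: "('a, 'm) ulgroup_scheme \<Rightarrow> 'a set topology" where
  "max_spectrum G = topology_generated_by
     {max_lideals G - {I \<in> max_lideals G. a \<in> I} | a. a \<in> carrier G}"

definition semisimple :: "('a, 'm) ulgroup_scheme \<Rightarrow> bool" where
  "semisimple G \<longleftrightarrow> {x \<in> carrier G. \<forall>I \<in> max_lideals G. x \<in> I} = {\<one>\<^bsub>G\<^esub>}"

text \<open>
  The quotient group \<open>G Mod I\<close> with the induced order, in which one coset lies below another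
  iff this holds for suitable representatives.
\<close>

definition ulquot :: "('a, 'm) ulgroup_scheme \<Rightarrow> 'a set \<Rightarrow> 'a set ulgroup" where
  "ulquot G I = monoid.extend (G Mod I)
     (ulgroup.fields (\<lambda>X Y. \<exists>x\<in>X. \<exists>y\<in>Y. x \<preceq>\<^bsub>G\<^esub> y) (I #>\<^bsub>G\<^esub> \<u>\<^bsub>G\<^esub>))"

definition int_ulgroup :: "int \<Rightarrow> int ulgroup" where
  "int_ulgroup v = \<lparr>carrier = UNIV, mult = (+), one = 0, leq = (\<le>), unt = v\<rparr>"

definition finite_rank :: "('a, 'm) ulgroup_scheme \<Rightarrow> 'a set \<Rightarrow> bool" where
  "finite_rank G I \<longleftrightarrow> (\<exists>v>0. uliso (ulquot G I) (int_ulgroup v) \<noteq> {})"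

definition unital_lsubgroup :: "'a set \<Rightarrow> ('a, 'm) ulgroup_scheme \<Rightarrow> bool" where
  "unital_lsubgroup S G \<longleftrightarrow> subgroup S G \<and> \<u>\<^bsub>G\<^esub> \<in> S \<and>
     (\<forall>x\<in>S. \<forall>y\<in>S. x \<squnion>\<^bsub>order_of G\<^esub> y \<in> S \<and> x \<sqinter>\<^bsub>order_of G\<^esub> y \<in> S)"

definition finitely_generated :: "('a, 'm) ulgroup_scheme \<Rightarrow> bool" where
  "finitely_generated G \<longleftrightarrow> (\<exists>A. finite A \<and> A \<subseteq> carrier G \<and>
     \<Inter>{S. unital_lsubgroup S G \<and> A \<subseteq> S} = carrier G)"

definition hopfian :: "('a, 'm) ulgroup_scheme \<Rightarrow> bool" where
  "hopfian G \<longleftrightarrow> (\<forall>h \<in> ulhom G G. h ` carrier G = carrier G \<longrightarrow> h \<in> uliso G G)"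

lemma order_of_simps [simp]:
  "carrier (order_of G) = carrier G" "eq (order_of G) = (=)" "le (order_of G) = leq G"
  by (simp_all add: order_of_def)

lemma ulquot_simps [simp]:
  "carrier (ulquot G I) = carrier (G Mod I)"
  "X \<otimes>\<^bsub>ulquot G I\<^esub> Y = X \<otimes>\<^bsub>G Mod I\<^esub> Y"
  "\<one>\<^bsub>ulquot G I\<^esub> = I"
  "X \<preceq>\<^bsub>ulquot G I\<^esub> Y \<longleftrightarrow> (\<exists>x\<in>X. \<exists>y\<in>Y. x \<preceq>\<^bsub>G\<^esub> y)"
  "\<u>\<^bsub>ulquot G I\<^esub> = I #>\<^bsub>G\<^esub> \<u>\<^bsub>G\<^esub>"
  by (simp_all add: ulquot_def monoid.extend_def ulgroup.fields_def FactGroup_def)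

lemma join_eqI:
  assumes "Lattice.lattice L" "least L s (Upper L {x, y})" "x \<in> carrier L" "y \<in> carrier L"
  shows "x \<squnion>\<^bsub>L\<^esub> y = s"
proof -
  interpret Lattice.lattice L by fact
  show ?thesis
    using assms(2-4) by (metis join_def sup_def least_unique someI_ex)
qed

lemma meet_eqI:
  assumes "Lattice.lattice L" "greatest L s (Lower L {x, y})" "x \<in> carrier L" "y \<in> carrier L"
  shows "x \<sqinter>\<^bsub>L\<^esub> y = s"
proof -
  interpret Lattice.lattice L by fact
  show ?thesis
    using assms(2-4) by (metis meet_def inf_def greatest_unique someI_ex)
qed

context
  fixes G :: "('a, 'm) ulgroup_scheme" and H :: "('b, 'n) ulgroup_scheme" and h
  assumes G: "unital_lgroup G" and H: "unital_lgroup H" and h: "h \<in> ulhom G H"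
begin

interpretation G: unital_lgroup G by (rule G)
interpretation H: unital_lgroup H by (rule H)
interpretation gh: group_hom G H h
  using h by unfold_locales (auto simp: ulhom_def)

private abbreviation "N \<equiv> kernel G H h"
private abbreviation "Q \<equiv> ulquot G N"

private lemma h_join: "x \<in> carrier G \<Longrightarrow> y \<in> carrier G \<Longrightarrow>
    h (x \<squnion>\<^bsub>order_of G\<^esub> y) = h x \<squnion>\<^bsub>order_of H\<^esub> h y"
  and h_meet: "x \<in> carrier G \<Longrightarrow> y \<in> carrier G \<Longrightarrow>
    h (x \<sqinter>\<^bsub>order_of G\<^esub> y) = h x \<sqinter>\<^bsub>order_of H\<^esub> h y"
  and h_unt: "h \<u>\<^bsub>G\<^esub> = \<u>\<^bsub>H\<^esub>"
  using h by (auto simp: ulhom_def join_pres_def meet_pres_def)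

private lemma h_mono:
  assumes "x \<in> carrier G" "y \<in> carrier G" "x \<preceq>\<^bsub>G\<^esub> y"
  shows "h x \<preceq>\<^bsub>H\<^esub> h y"
  using assms h_join[of x y] G.ord.le_iff_meet[of x y] H.ord.le_iff_meet[of "h x" "h y"]
    gh.hom_closed
  by simp

private lemma mem_coset: "x \<in> carrier G \<Longrightarrow> z \<in> N #>\<^bsub>G\<^esub> x \<longleftrightarrow> z \<in> carrier G \<and> h z = h x"
proof -
  assume x: "x \<in> carrier G"
  show ?thesis
  proof
    assume "z \<in> N #>\<^bsub>G\<^esub> x"
    then show "z \<in> carrier G \<and> h z = h x"
      using x by (auto simp: r_coset_def kernel_def)
  next
    assume z: "z \<in> carrier G \<and> h z = h x"
    then have "z \<otimes>\<^bsub>G\<^esub> inv\<^bsub>G\<^esub> x \<in> N" "z = (z \<otimes>\<^bsub>G\<^esub> inv\<^bsub>G\<^esub> x) \<otimes>\<^bsub>G\<^esub> x"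
      using x by (auto simp: kernel_def G.m_assoc)
    then show "z \<in> N #>\<^bsub>G\<^esub> x"
      unfolding r_coset_def by blast
  qed
qed

private lemma coset_eq:
  "x \<in> carrier G \<Longrightarrow> y \<in> carrier G \<Longrightarrow> N #>\<^bsub>G\<^esub> x = N #>\<^bsub>G\<^esub> y \<longleftrightarrow> h x = h y"
  by (auto simp: mem_coset set_eq_iff)

private lemma coset_leq:
  assumes "x \<in> carrier G" "y \<in> carrier G"
  shows "N #>\<^bsub>G\<^esub> x \<preceq>\<^bsub>Q\<^esub> N #>\<^bsub>G\<^esub> y \<longleftrightarrow> h x \<preceq>\<^bsub>H\<^esub> h y"
proof
  assume "N #>\<^bsub>G\<^esub> x \<preceq>\<^bsub>Q\<^esub> N #>\<^bsub>G\<^esub> y"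
  then show "h x \<preceq>\<^bsub>H\<^esub> h y"
    using assms by (auto simp: mem_coset) (metis h_mono)
next
  assume "h x \<preceq>\<^bsub>H\<^esub> h y"
  then have "h (x \<squnion>\<^bsub>order_of G\<^esub> y) = h y"
    using H.ord.le_iff_meet[of "h x" "h y"] assms by (simp add: h_join)
  moreover have "x \<squnion>\<^bsub>order_of G\<^esub> y \<in> carrier G" "x \<preceq>\<^bsub>G\<^esub> x \<squnion>\<^bsub>order_of G\<^esub> y"
    using assms G.ord.join_closed[of x y] G.ord.join_left[of x y] by auto
  ultimately have "x \<in> N #>\<^bsub>G\<^esub> x" "x \<squnion>\<^bsub>order_of G\<^esub> y \<in> N #>\<^bsub>G\<^esub> y"
    "x \<preceq>\<^bsub>G\<^esub> x \<squnion>\<^bsub>order_of G\<^esub> y"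
    using assms by (simp_all only: mem_coset)
  then show "N #>\<^bsub>G\<^esub> x \<preceq>\<^bsub>Q\<^esub> N #>\<^bsub>G\<^esub> y"
    unfolding ulquot_simps by blast
qed

private lemma carrier_Q: "carrier Q = (\<lambda>x. N #>\<^bsub>G\<^esub> x) ` carrier G"
  by (simp add: carrier_FactGroup)

private lemma Q_comm_group: "comm_group Q"
proof -
  interpret M: comm_group "G Mod N"
    using G.abelian_FactGroup gh.subgroup_kernel by blast
  show ?thesis
    by (rule comm_groupI)
      (simp_all only: ulquot_simps, fact M.m_closed, fact M.one_closed[unfolded one_FactGroup],
        fact M.m_assoc, fact M.m_comm, fact M.l_one[unfolded one_FactGroup],
        fact M.l_inv_ex[unfolded one_FactGroup])
qed

private lemma coset_mult: "x \<in> carrier G \<Longrightarrow> y \<in> carrier G \<Longrightarrow>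
    (N #>\<^bsub>G\<^esub> x) \<otimes>\<^bsub>Q\<^esub> (N #>\<^bsub>G\<^esub> y) = N #>\<^bsub>G\<^esub> (x \<otimes>\<^bsub>G\<^esub> y)"
  using normal.rcos_sum[OF gh.normal_kernel] by simp

private lemma coset_one: "\<one>\<^bsub>Q\<^esub> = N #>\<^bsub>G\<^esub> \<one>\<^bsub>G\<^esub>"
  using gh.subgroup_kernel G.coset_mult_one subgroup.subset by fastforce

private lemma coset_join:
  assumes "x \<in> carrier G" "y \<in> carrier G"
  shows "least (order_of Q) (N #>\<^bsub>G\<^esub> (x \<squnion>\<^bsub>order_of G\<^esub> y))
    (Upper (order_of Q) {N #>\<^bsub>G\<^esub> x, N #>\<^bsub>G\<^esub> y})"
proof -
  let ?s = "x \<squnion>\<^bsub>order_of G\<^esub> y"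
  have s: "?s \<in> carrier G"
    using assms G.ord.join_closed[of x y] by simp
  have ub: "h x \<preceq>\<^bsub>H\<^esub> h ?s" "h y \<preceq>\<^bsub>H\<^esub> h ?s"
    using assms H.ord.join_left[of "h x" "h y"] H.ord.join_right[of "h x" "h y"] by (auto simp: h_join)
  have lub: "(N #>\<^bsub>G\<^esub> ?s) \<preceq>\<^bsub>Q\<^esub> W"
    if W: "W \<in> carrier Q" "(N #>\<^bsub>G\<^esub> x) \<preceq>\<^bsub>Q\<^esub> W" "(N #>\<^bsub>G\<^esub> y) \<preceq>\<^bsub>Q\<^esub> W" for W
  proof -
    obtain w where w: "w \<in> carrier G" "W = N #>\<^bsub>G\<^esub> w"
      using W(1) unfolding carrier_Q by (rule imageE)
    have "h x \<preceq>\<^bsub>H\<^esub> h w" "h y \<preceq>\<^bsub>H\<^esub> h w"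
      using W w(1) assms unfolding w(2) by (simp_all only: coset_leq)
    then have "h ?s \<preceq>\<^bsub>H\<^esub> h w"
      using w assms H.ord.join_le[of "h x" "h w" "h y"] by (simp add: h_join)
    then show ?thesis
      using w(1) s unfolding w(2) by (simp only: coset_leq)
  qed
  have "(N #>\<^bsub>G\<^esub> x) \<preceq>\<^bsub>Q\<^esub> (N #>\<^bsub>G\<^esub> ?s)" "(N #>\<^bsub>G\<^esub> y) \<preceq>\<^bsub>Q\<^esub> (N #>\<^bsub>G\<^esub> ?s)"
    using ub s assms by (simp_all only: coset_leq)
  moreover have "N #>\<^bsub>G\<^esub> x \<in> carrier Q" "N #>\<^bsub>G\<^esub> y \<in> carrier Q" "N #>\<^bsub>G\<^esub> ?s \<in> carrier Q"
    using s assms by (simp_all only: carrier_Q imageI)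
  ultimately show ?thesis
    using lub by (auto simp: least_def Upper_def simp del: ulquot_simps)
qed

private lemma coset_meet:
  assumes "x \<in> carrier G" "y \<in> carrier G"
  shows "greatest (order_of Q) (N #>\<^bsub>G\<^esub> (x \<sqinter>\<^bsub>order_of G\<^esub> y))
    (Lower (order_of Q) {N #>\<^bsub>G\<^esub> x, N #>\<^bsub>G\<^esub> y})"
proof -
  let ?s = "x \<sqinter>\<^bsub>order_of G\<^esub> y"
  have s: "?s \<in> carrier G"
    using assms G.ord.meet_closed[of x y] by simp
  have ub: "h ?s \<preceq>\<^bsub>H\<^esub> h x" "h ?s \<preceq>\<^bsub>H\<^esub> h y"
    using assms H.ord.meet_left[of "h x" "h y"] H.ord.meet_right[of "h x" "h y"] by (auto simp: h_meet)
  have lub: "W \<preceq>\<^bsub>Q\<^esub> (N #>\<^bsub>G\<^esub> ?s)"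
    if W: "W \<in> carrier Q" "W \<preceq>\<^bsub>Q\<^esub> (N #>\<^bsub>G\<^esub> x)" "W \<preceq>\<^bsub>Q\<^esub> (N #>\<^bsub>G\<^esub> y)" for W
  proof -
    obtain w where w: "w \<in> carrier G" "W = N #>\<^bsub>G\<^esub> w"
      using W(1) unfolding carrier_Q by (rule imageE)
    have "h w \<preceq>\<^bsub>H\<^esub> h x" "h w \<preceq>\<^bsub>H\<^esub> h y"
      using W w(1) assms unfolding w(2) by (simp_all only: coset_leq)
    then have "h w \<preceq>\<^bsub>H\<^esub> h ?s"
      using w assms H.ord.meet_le[of "h w" "h x" "h y"] by (simp add: h_meet)
    then show ?thesis
      using w(1) s unfolding w(2) by (simp only: coset_leq)
  qed
  have "(N #>\<^bsub>G\<^esub> ?s) \<preceq>\<^bsub>Q\<^esub> (N #>\<^bsub>G\<^esub> x)" "(N #>\<^bsub>G\<^esub> ?s) \<preceq>\<^bsub>Q\<^esub> (N #>\<^bsub>G\<^esub> y)"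
    using ub s assms by (simp_all only: coset_leq)
  moreover have "N #>\<^bsub>G\<^esub> x \<in> carrier Q" "N #>\<^bsub>G\<^esub> y \<in> carrier Q" "N #>\<^bsub>G\<^esub> ?s \<in> carrier Q"
    using s assms by (simp_all only: carrier_Q imageI)
  ultimately show ?thesis
    using lub by (auto simp: greatest_def Lower_def simp del: ulquot_simps)
qed

private lemma Q_lattice: "Lattice.lattice (order_of Q)"
proof
  fix X Y Z
  show "X \<in> carrier (order_of Q) \<Longrightarrow> X .=\<^bsub>order_of Q\<^esub> X" by simp
  show "X .=\<^bsub>order_of Q\<^esub> Y \<Longrightarrow> X \<in> carrier (order_of Q) \<Longrightarrow> Y \<in> carrier (order_of Q) \<Longrightarrow>
    Y .=\<^bsub>order_of Q\<^esub> X" by simp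
  show "X .=\<^bsub>order_of Q\<^esub> Y \<Longrightarrow> Y .=\<^bsub>order_of Q\<^esub> Z \<Longrightarrow> X \<in> carrier (order_of Q) \<Longrightarrow>
    Y \<in> carrier (order_of Q) \<Longrightarrow> Z \<in> carrier (order_of Q) \<Longrightarrow> X .=\<^bsub>order_of Q\<^esub> Z" by simp
  show "(.=\<^bsub>order_of Q\<^esub>) = (=)" by simp
  show "X \<in> carrier (order_of Q) \<Longrightarrow> X \<sqsubseteq>\<^bsub>order_of Q\<^esub> X"
    using H.ord.le_refl by (auto simp: carrier_Q coset_leq simp del: ulquot_simps)
  show "X \<sqsubseteq>\<^bsub>order_of Q\<^esub> Y \<Longrightarrow> Y \<sqsubseteq>\<^bsub>order_of Q\<^esub> X \<Longrightarrow> X \<in> carrier (order_of Q) \<Longrightarrow>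
    Y \<in> carrier (order_of Q) \<Longrightarrow> X .=\<^bsub>order_of Q\<^esub> Y"
    using H.ord.le_antisym
    by (simp only: order_of_simps carrier_Q, elim imageE)
      (simp add: coset_leq coset_eq del: ulquot_simps)
  show "X \<sqsubseteq>\<^bsub>order_of Q\<^esub> Y \<Longrightarrow> Y \<sqsubseteq>\<^bsub>order_of Q\<^esub> Z \<Longrightarrow> X \<in> carrier (order_of Q) \<Longrightarrow>
    Y \<in> carrier (order_of Q) \<Longrightarrow> Z \<in> carrier (order_of Q) \<Longrightarrow> X \<sqsubseteq>\<^bsub>order_of Q\<^esub> Z"
    using H.ord.le_trans by (auto simp: carrier_Q coset_leq simp del: ulquot_simps)
  show "\<exists>s. least (order_of Q) s (Upper (order_of Q) {X, Y})"
    if "X \<in> carrier (order_of Q)" "Y \<in> carrier (order_of Q)"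
    using that coset_join by (fastforce simp: carrier_Q simp del: ulquot_simps)
  show "\<exists>s. greatest (order_of Q) s (Lower (order_of Q) {X, Y})"
    if "X \<in> carrier (order_of Q)" "Y \<in> carrier (order_of Q)"
    using that coset_meet by (fastforce simp: carrier_Q simp del: ulquot_simps)
qed (simp_all del: ulquot_simps)

private lemma coset_hom: "(\<lambda>x. N #>\<^bsub>G\<^esub> x) \<in> hom G Q"
  by (rule homI) (auto simp: carrier_Q coset_mult simp del: ulquot_simps)

lemma ulquot_kernel_unital_lgroup: "unital_lgroup (ulquot G (kernel G H h))"
proof -
  interpret Q: comm_group Q by (rule Q_comm_group)
  interpret ord: Lattice.lattice "order_of Q" by (rule Q_lattice)
  interpret c: group_hom G Q "\<lambda>x. N #>\<^bsub>G\<^esub> x"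
    using coset_hom by unfold_locales
  have Hnt: "\<one>\<^bsub>H\<^esub> \<noteq> \<u>\<^bsub>H\<^esub>"
  proof
    assume eq: "\<one>\<^bsub>H\<^esub> = \<u>\<^bsub>H\<^esub>"
    have pos: "x = \<one>\<^bsub>H\<^esub>" if "x \<in> carrier H" "\<one>\<^bsub>H\<^esub> \<preceq>\<^bsub>H\<^esub> x" for x
    proof -
      obtain n :: int where "x \<preceq>\<^bsub>H\<^esub> \<u>\<^bsub>H\<^esub> [^]\<^bsub>H\<^esub> n"
        using H.unit_dominates[OF \<open>x \<in> carrier H\<close> \<open>\<one>\<^bsub>H\<^esub> \<preceq>\<^bsub>H\<^esub> x\<close>] by (elim exE)
      then have "x \<preceq>\<^bsub>H\<^esub> \<one>\<^bsub>H\<^esub>"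
        unfolding eq[symmetric] H.int_pow_one .
      then show ?thesis
        using \<open>x \<in> carrier H\<close> \<open>\<one>\<^bsub>H\<^esub> \<preceq>\<^bsub>H\<^esub> x\<close> H.ord.le_antisym[of x "\<one>\<^bsub>H\<^esub>"] by simp
    qed
    have "x = \<one>\<^bsub>H\<^esub>" if x: "x \<in> carrier H" for x
    proof -
      have j: "x \<squnion>\<^bsub>order_of H\<^esub> \<one>\<^bsub>H\<^esub> = \<one>\<^bsub>H\<^esub>"
        using pos[of "x \<squnion>\<^bsub>order_of H\<^esub> \<one>\<^bsub>H\<^esub>"] x
          H.ord.join_right[of x "\<one>\<^bsub>H\<^esub>"] H.ord.join_closed[of x "\<one>\<^bsub>H\<^esub>"] by simp
      then have le: "x \<preceq>\<^bsub>H\<^esub> \<one>\<^bsub>H\<^esub>"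
        using H.ord.join_left[of x "\<one>\<^bsub>H\<^esub>"] x by simp
      have "inv\<^bsub>H\<^esub> x = \<one>\<^bsub>H\<^esub>"
        using pos[of "inv\<^bsub>H\<^esub> x"] H.translation_invariant[OF x _ _ le, of "inv\<^bsub>H\<^esub> x"] x by simp
      then show ?thesis using x by (metis H.inv_inv H.inv_one)
    qed
    then show False using H.nontrivial by auto
  qed
  have trans: "Z \<otimes>\<^bsub>Q\<^esub> X \<preceq>\<^bsub>Q\<^esub> Z \<otimes>\<^bsub>Q\<^esub> Y"
    if "X \<in> carrier Q" "Y \<in> carrier Q" "Z \<in> carrier Q" "X \<preceq>\<^bsub>Q\<^esub> Y" for X Y Z
  proof -
    obtain x y z where eq: "X = N #>\<^bsub>G\<^esub> x" "Y = N #>\<^bsub>G\<^esub> y" "Z = N #>\<^bsub>G\<^esub> z"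
      and xyz: "x \<in> carrier G" "y \<in> carrier G" "z \<in> carrier G"
      using \<open>X \<in> carrier Q\<close> \<open>Y \<in> carrier Q\<close> \<open>Z \<in> carrier Q\<close> unfolding carrier_Q by blast
    have "h x \<preceq>\<^bsub>H\<^esub> h y"
      using that(4) xyz unfolding eq by (simp only: coset_leq)
    then have "h (z \<otimes>\<^bsub>G\<^esub> x) \<preceq>\<^bsub>H\<^esub> h (z \<otimes>\<^bsub>G\<^esub> y)"
      using xyz by (simp add: H.translation_invariant)
    then show ?thesis
      using xyz unfolding eq by (simp only: coset_mult coset_leq G.m_closed)
  qed
  have u: "\<u>\<^bsub>Q\<^esub> \<in> carrier Q"
    using G.unit_closed by (auto simp: carrier_FactGroup)
  have coset_u: "\<u>\<^bsub>Q\<^esub> = N #>\<^bsub>G\<^esub> \<u>\<^bsub>G\<^esub>"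
    by simp
  have pos: "\<one>\<^bsub>Q\<^esub> \<preceq>\<^bsub>Q\<^esub> \<u>\<^bsub>Q\<^esub>"
    using H.unit_nonneg unfolding coset_one coset_u
    by (simp only: coset_leq G.unit_closed G.one_closed h_unt gh.hom_one)
  have nt: "\<one>\<^bsub>Q\<^esub> \<noteq> \<u>\<^bsub>Q\<^esub>"
    using Hnt unfolding coset_one coset_u
    by (simp only: coset_eq G.unit_closed G.one_closed h_unt gh.hom_one) simp
  have dom: "\<exists>n::int. X \<preceq>\<^bsub>Q\<^esub> \<u>\<^bsub>Q\<^esub> [^]\<^bsub>Q\<^esub> n"
    if X: "X \<in> carrier Q" "\<one>\<^bsub>Q\<^esub> \<preceq>\<^bsub>Q\<^esub> X" for X
  proof -
    obtain x where x: "x \<in> carrier G" "X = N #>\<^bsub>G\<^esub> x"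
      using X(1) unfolding carrier_Q by (rule imageE)
    have 1: "\<one>\<^bsub>H\<^esub> \<preceq>\<^bsub>H\<^esub> h x"
      using X(2) x(1) unfolding x(2) coset_one by (simp only: coset_leq G.one_closed gh.hom_one)
    obtain n :: int where n: "h x \<preceq>\<^bsub>H\<^esub> \<u>\<^bsub>H\<^esub> [^]\<^bsub>H\<^esub> n"
      using H.unit_dominates[OF gh.hom_closed[OF x(1)] 1] by (elim exE)
    have "h (\<u>\<^bsub>G\<^esub> [^]\<^bsub>G\<^esub> n) = \<u>\<^bsub>H\<^esub> [^]\<^bsub>H\<^esub> n"
      using gh.hom_int_pow[OF G.unit_closed, of n] unfolding h_unt .
    then have "X \<preceq>\<^bsub>Q\<^esub> N #>\<^bsub>G\<^esub> (\<u>\<^bsub>G\<^esub> [^]\<^bsub>G\<^esub> n)"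
      using n x(1) unfolding x(2) by (simp only: coset_leq G.unit_closed G.int_pow_closed)
    moreover have "N #>\<^bsub>G\<^esub> (\<u>\<^bsub>G\<^esub> [^]\<^bsub>G\<^esub> n) = \<u>\<^bsub>Q\<^esub> [^]\<^bsub>Q\<^esub> n"
      unfolding coset_u by (rule c.hom_int_pow[OF G.unit_closed])
    ultimately have "X \<preceq>\<^bsub>Q\<^esub> \<u>\<^bsub>Q\<^esub> [^]\<^bsub>Q\<^esub> n" by (simp only:)
    then show ?thesis by (rule exI)
  qed
  show ?thesis
    by (rule unital_lgroup.intro[OF Q_comm_group Q_lattice unital_lgroup_axioms.intro])
      (fact trans, fact u, fact pos, fact dom, use u nt in blast)
qed

lemma coset_map_ulhom:
  "(\<lambda>x. kernel G H h #>\<^bsub>G\<^esub> x) \<in> ulhom G (ulquot G (kernel G H h))"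
proof -
  have "N #>\<^bsub>G\<^esub> x \<in> carrier (order_of Q)" if "x \<in> carrier G" for x
    using that by (simp add: carrier_FactGroup)
  then show ?thesis
    using coset_hom join_eqI[OF Q_lattice coset_join] meet_eqI[OF Q_lattice coset_meet]
      Q_lattice G.ord.lattice_axioms
    by (auto simp: ulhom_def join_pres_def meet_pres_def)
qed

lemma kernel_is_lideal: "lideal (kernel G H h) G"
proof -
  interpret Q: unital_lgroup Q by (rule ulquot_kernel_unital_lgroup)
  have "N = kernel G Q (\<lambda>x. N #>\<^bsub>G\<^esub> x)"
  proof -
    have "x \<in> N \<longleftrightarrow> x \<in> carrier G \<and> N #>\<^bsub>G\<^esub> x = N #>\<^bsub>G\<^esub> \<one>\<^bsub>G\<^esub>" for x
      using coset_eq[of x "\<one>\<^bsub>G\<^esub>"] by (auto simp: kernel_def simp del: ulquot_simps)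
    then show ?thesis
      unfolding kernel_def[of G Q] coset_one by blast
  qed
  moreover have "N \<noteq> carrier G"
  proof
    assume "N = carrier G"
    then have "N #>\<^bsub>G\<^esub> x = \<one>\<^bsub>Q\<^esub>" if "x \<in> carrier G" for x
      using that coset_eq[of x "\<one>\<^bsub>G\<^esub>"] coset_one by (auto simp: kernel_def)
    then show False
      using Q.nontrivial by (auto simp: carrier_FactGroup)
  qed
  ultimately show ?thesis
    unfolding lideal_def using Q.unital_lgroup_axioms coset_map_ulhom by blast
qed

end

end

theory Submission
  imports Defs
begin

text \<open>
  For fixed \<open>v\<close> the set \<open>F\<close> of homomorphisms from \<open>G\<close> to \<open>(\<int>, v)\<close> is finite: such a map is
  determined by its values on the finitely many generators, and these values are bounded because
  every element of \<open>G\<close> lies between two multiples of the unit.  If \<open>h\<close> maps \<open>G\<close> onto \<open>G\<close>, then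
  \<open>f \<mapsto> f \<circ> h\<close> is an injection of \<open>F\<close> into itself, hence onto, so every \<open>f \<in> F\<close> vanishes on the
  kernel of \<open>h\<close>.  Density and semisimplicity provide, for each \<open>x\<close> other than zero, some \<open>v\<close> and
  some \<open>f \<in> F\<close> with \<open>f x \<noteq> 0\<close>.
\<close>

lemma ulhom_group_hom:
  assumes "group G" "group H" "f \<in> ulhom G H"
  shows "group_hom G H f"
  using assms by (simp add: group_hom_def group_hom_axioms_def ulhom_def)

lemma
  assumes "f \<in> ulhom G H" "x \<in> carrier G" "y \<in> carrier G"
  shows ulhom_closed: "f x \<in> carrier H"
    and ulhom_mult: "f (x \<otimes>\<^bsub>G\<^esub> y) = f x \<otimes>\<^bsub>H\<^esub> f y"
    and ulhom_join: "f (x \<squnion>\<^bsub>order_of G\<^esub> y) = f x \<squnion>\<^bsub>order_of H\<^esub> f y"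
    and ulhom_meet: "f (x \<sqinter>\<^bsub>order_of G\<^esub> y) = f x \<sqinter>\<^bsub>order_of H\<^esub> f y"
  using assms
  by (auto simp: ulhom_def join_pres_def meet_pres_def hom_def)

lemma ulhom_unit: "f \<in> ulhom G H \<Longrightarrow> f \<u>\<^bsub>G\<^esub> = \<u>\<^bsub>H\<^esub>"
  by (simp add: ulhom_def)

lemma ulhom_mono:
  assumes f: "f \<in> ulhom G H" and xy: "x \<in> carrier G" "y \<in> carrier G" "x \<preceq>\<^bsub>G\<^esub> y"
  shows "f x \<preceq>\<^bsub>H\<^esub> f y"
proof -
  \<comment> \<open>\<open>join_pres\<close> includes that both orders are lattices. Since
    \<open>x \<preceq> y\<close> says that the join of \<open>x\<close> and \<open>y\<close> is
    \<open>y\<close>, preserving joins forces monotonicity.\<close>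
  interpret G: Lattice.lattice "order_of G"
    using f by (simp add: ulhom_def join_pres_def)
  interpret H: Lattice.lattice "order_of H"
    using f by (simp add: ulhom_def join_pres_def)
  show ?thesis
    using xy G.le_iff_meet[of x y] H.le_iff_meet[of "f x" "f y"]
      ulhom_join[OF f xy(1,2)] ulhom_closed[OF f xy(1,1)] ulhom_closed[OF f xy(2,2)]
    by simp
qed

lemma ulhom_comp:
  assumes "f \<in> ulhom G H" "g \<in> ulhom H K"
  shows "g \<circ> f \<in> ulhom G K"
  using assms
  by (auto simp: ulhom_def join_pres_def meet_pres_def hom_def Pi_iff)

text \<open>Every condition in \<open>ulhom\<close> evaluates the map only on the carrier, which
  contains the unit and is closed under the operations. This permits replacing \<open>g\<close> by
  \<open>restrict g (carrier G)\<close>.\<close>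

lemma ulhom_cong:
  assumes "unital_lgroup G" "f \<in> ulhom G H" "\<And>x. x \<in> carrier G \<Longrightarrow> g x = f x"
  shows "g \<in> ulhom G H"
proof -
  interpret G: unital_lgroup G by fact
  show ?thesis
    using assms(2) G.unit_closed G.ord.join_closed G.ord.meet_closed
    by (auto simp: ulhom_def join_pres_def meet_pres_def hom_def Pi_iff assms(3))
qed

lemma int_ulgroup_group: "group (int_ulgroup v)"
proof (rule groupI)
  show "\<exists>y\<in>carrier (int_ulgroup v). y \<otimes>\<^bsub>int_ulgroup v\<^esub> x = \<one>\<^bsub>int_ulgroup v\<^esub>" for x
    by (rule bexI[of _ "- x"]) (simp_all add: int_ulgroup_def)
qed (simp_all add: int_ulgroup_def)

lemma equalizer_unital_lsubgroup:
  assumes G: "unital_lgroup G" and H: "group H" and f: "f \<in> ulhom G H" and g: "g \<in> ulhom G H"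
  shows "unital_lsubgroup {x \<in> carrier G. f x = g x} G"
proof -
  interpret G: unital_lgroup G by fact
  interpret f: group_hom G H f by (rule ulhom_group_hom[OF G.is_group H f])
  interpret g: group_hom G H g by (rule ulhom_group_hom[OF G.is_group H g])
  have "subgroup {x \<in> carrier G. f x = g x} G"
    by (rule G.subgroupI) (auto intro!: exI[of _ "\<one>\<^bsub>G\<^esub>"])
  then show ?thesis
    using G.unit_closed G.ord.join_closed G.ord.meet_closed
    by (auto simp: unital_lsubgroup_def ulhom_unit[OF f] ulhom_unit[OF g]
      ulhom_join[OF f] ulhom_join[OF g] ulhom_meet[OF f] ulhom_meet[OF g])
qed

text \<open>The equalizer of \<open>f\<close> and \<open>g\<close> contains \<open>A\<close>, so it
  is one of the sets \<open>S\<close> whose intersection is \<open>carrier G\<close>.\<close>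

lemma ulhom_eqI:
  assumes "unital_lgroup G" "group H" "f \<in> ulhom G H" "g \<in> ulhom G H"
    and gen: "\<Inter>{S. unital_lsubgroup S G \<and> A \<subseteq> S} = carrier G"
    and A: "A \<subseteq> carrier G" "\<And>a. a \<in> A \<Longrightarrow> f a = g a"
    and x: "x \<in> carrier G"
  shows "f x = g x"
  using equalizer_unital_lsubgroup[OF assms(1-4)] A x gen by blast

text \<open>The axiom \<open>unit_dominates\<close> is applied to the positive part of
  \<open>x\<close>, its join with zero.\<close>

lemma (in unital_lgroup) le_int_pow_unit:
  assumes x: "x \<in> carrier G"
  shows "\<exists>n::int. x \<preceq> \<u> [^] n"
proof -
  let ?y = "x \<squnion>\<^bsub>order_of G\<^esub> \<one>"
  have y: "?y \<in> carrier G" "x \<preceq> ?y" "\<one> \<preceq> ?y"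
    using x ord.join_closed[of x \<one>] ord.join_left[of x \<one>] ord.join_right[of x \<one>] by auto
  then obtain n :: int where "?y \<preceq> \<u> [^] n"
    using unit_dominates by blast
  then show ?thesis
    using ord.le_trans[of x ?y "\<u> [^] n"] x y unit_closed by auto
qed

lemma ulhom_int_bounded:
  assumes G: "unital_lgroup G" and x: "x \<in> carrier G"
  shows "\<exists>B. finite B \<and> (\<forall>f \<in> ulhom G (int_ulgroup v). f x \<in> B)"
proof -
  interpret G: unital_lgroup G by fact
  let ?Z = "int_ulgroup v"
  \<comment> \<open>The multiples are fixed before \<open>f\<close>, so the resulting interval
    depends only on \<open>x\<close> and \<open>v\<close>. Bounding the inverse from above bounds
    \<open>f x\<close> from below.\<close>
  obtain m n :: int where m: "inv\<^bsub>G\<^esub> x \<preceq>\<^bsub>G\<^esub> \<u>\<^bsub>G\<^esub> [^]\<^bsub>G\<^esub> m" and n: "x \<preceq>\<^bsub>G\<^esub> \<u>\<^bsub>G\<^esub> [^]\<^bsub>G\<^esub> n"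
    using x G.le_int_pow_unit G.inv_closed by metis
  have "f x \<in> {- (v [^]\<^bsub>?Z\<^esub> m)..v [^]\<^bsub>?Z\<^esub> n}" if f: "f \<in> ulhom G ?Z" for f
  proof -
    interpret f: group_hom G ?Z f by (rule ulhom_group_hom[OF G.is_group int_ulgroup_group f])
    have pow: "f (\<u>\<^bsub>G\<^esub> [^]\<^bsub>G\<^esub> k) = v [^]\<^bsub>?Z\<^esub> k" for k :: int
      using f.hom_int_pow[OF G.unit_closed, of k] ulhom_unit[OF f] by (simp add: int_ulgroup_def)
    have "f x \<otimes>\<^bsub>?Z\<^esub> f (inv\<^bsub>G\<^esub> x) = \<one>\<^bsub>?Z\<^esub>"
      using x by (metis G.inv_closed G.r_inv f.hom_mult f.hom_one)
    then have inv: "f (inv\<^bsub>G\<^esub> x) = - f x"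
      by (simp add: int_ulgroup_def)
    have "f x \<preceq>\<^bsub>?Z\<^esub> v [^]\<^bsub>?Z\<^esub> n" "f (inv\<^bsub>G\<^esub> x) \<preceq>\<^bsub>?Z\<^esub> v [^]\<^bsub>?Z\<^esub> m"
      using ulhom_mono[OF f _ _ n] ulhom_mono[OF f _ _ m] x G.unit_closed
      unfolding pow by simp_all
    then have "f x \<le> v [^]\<^bsub>?Z\<^esub> n" "f (inv\<^bsub>G\<^esub> x) \<le> v [^]\<^bsub>?Z\<^esub> m"
      by (simp_all add: int_ulgroup_def)
    then show ?thesis
      by (simp add: inv)
  qed
  then show ?thesis
    by blast
qed

text \<open>HOL functions are total; \<open>extensional (carrier G)\<close> fixes the values off the
  carrier, so that each homomorphism is counted once.\<close>

lemma finite_ulhom_int: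
  assumes G: "unital_lgroup G" and fg: "finitely_generated G"
  shows "finite (ulhom G (int_ulgroup v) \<inter> extensional (carrier G))" (is "finite ?F")
proof -
  obtain A where A: "finite A" "A \<subseteq> carrier G"
    and gen: "\<Inter>{S. unital_lsubgroup S G \<and> A \<subseteq> S} = carrier G"
    using fg unfolding finitely_generated_def by blast
  obtain B where B: "\<And>x. x \<in> carrier G \<Longrightarrow> finite (B x)"
    "\<And>x f. x \<in> carrier G \<Longrightarrow> f \<in> ulhom G (int_ulgroup v) \<Longrightarrow> f x \<in> B x"
    using ulhom_int_bounded[OF G, of _ v] by metis
  \<comment> \<open>Restriction to the generators embeds \<open>?F\<close> into a finite product of
    the bounding sets.\<close>
  have "(\<lambda>f. restrict f A) ` ?F \<subseteq> PiE A B"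
    using A(2) B(2) by (auto simp: PiE_iff)
  moreover have "finite (PiE A B)"
    using A B(1) by (auto intro!: finite_PiE)
  moreover have "inj_on (\<lambda>f. restrict f A) ?F"
  proof (rule inj_onI)
    fix f g
    assume f: "f \<in> ?F" and g: "g \<in> ?F" and eq: "restrict f A = restrict g A"
    have "f a = g a" if "a \<in> A" for a
      using fun_cong[OF eq, of a] that by simp
    then have "f x = g x" if "x \<in> carrier G" for x
      using ulhom_eqI[OF G int_ulgroup_group _ _ gen A(2) _ that] f g by blast
    then show "f = g"
      using f g by (auto intro: extensionalityI)
  qed
  ultimately show ?thesis
    using finite_imageD finite_subset by blast
qed

lemma ulhom_int_factors:
  assumes G: "unital_lgroup G" and fg: "finitely_generated G"
    and h: "h \<in> ulhom G G" "h ` carrier G = carrier G" and f: "f \<in> ulhom G (int_ulgroup v)"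
  shows "\<exists>g \<in> ulhom G (int_ulgroup v). \<forall>x \<in> carrier G. f x = g (h x)"
proof -
  interpret G: unital_lgroup G by fact
  let ?F = "ulhom G (int_ulgroup v) \<inter> extensional (carrier G)"
  let ?c = "\<lambda>g. restrict (g \<circ> h) (carrier G)"
  have F: "restrict g (carrier G) \<in> ?F" if "g \<in> ulhom G (int_ulgroup v)" for g
    using ulhom_cong[OF G that] by auto
  have "?c ` ?F \<subseteq> ?F"
    using F ulhom_comp[OF h(1)] by blast
  moreover have "inj_on ?c ?F"
  proof (rule inj_onI)
    fix g k
    assume gk: "g \<in> ?F" "k \<in> ?F" and eq: "?c g = ?c k"
    have "g (h x) = k (h x)" if "x \<in> carrier G" for x
      using fun_cong[OF eq, of x] that by simp
    \<comment> \<open>As \<open>h\<close> is onto, every \<open>y\<close> has the form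
      \<open>h x\<close>.\<close>
    then have "g y = k y" if "y \<in> carrier G" for y
      using that h(2) by (metis imageE)
    then show "g = k"
      using gk by (auto intro: extensionalityI)
  qed
  \<comment> \<open>An injective self-map of a finite set is onto, so the restriction of
    \<open>f\<close> is itself of the form \<open>?c g\<close>.\<close>
  ultimately have "?c ` ?F = ?F"
    using endo_inj_surj[OF finite_ulhom_int[OF G fg]] by blast
  then obtain g where g: "g \<in> ?F" "restrict f (carrier G) = ?c g"
    using F[OF f] by blast
  have "f x = g (h x)" if "x \<in> carrier G" for x
    using fun_cong[OF g(2), of x] that by simp
  then show ?thesis
    using g(1) by blast
qed

text \<open>The homomorphism is the coset map followed by the isomorphism of the quotient with the
  integers; \<open>v\<close> is the image of the unit and may vary with \<open>I\<close>.\<close>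

lemma finite_rank_separates:
  assumes G: "unital_lgroup G" and I: "lideal I G" "finite_rank G I"
    and x: "x \<in> carrier G" "x \<notin> I"
  shows "\<exists>v. \<exists>f \<in> ulhom G (int_ulgroup v). f x \<noteq> 0"
proof -
  interpret G: unital_lgroup G by fact
  \<comment> \<open>Writing \<open>I\<close> as a kernel gives access to the facts about
    \<open>ulquot\<close>, which are stated for kernels.\<close>
  obtain H :: "'a set ulgroup" and h where H: "unital_lgroup H" "h \<in> ulhom G H" "I = kernel G H h"
    using I(1) unfolding lideal_def by blast
  interpret H: unital_lgroup H by (rule H(1))
  interpret h: group_hom G H h by (rule ulhom_group_hom[OF G.is_group H.is_group H(2)])
  interpret Q: unital_lgroup "ulquot G I"
    unfolding H(3) by (rule ulquot_kernel_unital_lgroup[OF G H(1,2)])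
  have c: "(\<lambda>x. I #>\<^bsub>G\<^esub> x) \<in> ulhom G (ulquot G I)"
    unfolding H(3) by (rule coset_map_ulhom[OF G H(1,2)])
  have sub: "subgroup I G"
    unfolding H(3) by (rule h.subgroup_kernel)
  obtain v k where k: "k \<in> ulhom (ulquot G I) (int_ulgroup v)"
    "bij_betw k (carrier (ulquot G I)) (carrier (int_ulgroup v))"
    using I(2) unfolding finite_rank_def uliso_def by blast
  interpret k: group_hom "ulquot G I" "int_ulgroup v" k
    by (rule ulhom_group_hom[OF Q.is_group int_ulgroup_group k(1)])
  \<comment> \<open>The zero of the quotient is \<open>I\<close> itself, and the coset of
    \<open>x\<close> equals \<open>I\<close> only if \<open>x\<close> lies in
    \<open>I\<close>.\<close>
  have "I #>\<^bsub>G\<^esub> x \<noteq> \<one>\<^bsub>ulquot G I\<^esub>"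
    using G.coset_join1[OF _ x(1) sub] x(2) subgroup.subset[OF sub] by auto
  then have "k (I #>\<^bsub>G\<^esub> x) \<noteq> k \<one>\<^bsub>ulquot G I\<^esub>"
    using inj_onD[OF bij_betw_imp_inj_on[OF k(2)]] ulhom_closed[OF c x(1,1)] Q.one_closed
    by blast
  moreover have "k \<one>\<^bsub>ulquot G I\<^esub> = 0"
    unfolding k.hom_one by (simp add: int_ulgroup_def)
  ultimately show ?thesis
    using ulhom_comp[OF c k(1)] by (intro exI[of _ v] bexI) auto
qed

theorem corollary3p1:
  fixes G :: "'a ulgroup"
  assumes "unital_lgroup G"
    and "finitely_generated G"
    and "semisimple G"
    and "max_spectrum G closure_of {I \<in> max_lideals G. finite_rank G I} = topspace (max_spectrum G)"
  shows "hopfian G"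
  unfolding hopfian_def
proof (intro ballI impI)
  fix h
  assume h: "h \<in> ulhom G G" "h ` carrier G = carrier G"
  interpret G: unital_lgroup G by fact
  interpret h: group_hom G G h by (rule ulhom_group_hom[OF G.is_group G.is_group h(1)])
  have "x = \<one>\<^bsub>G\<^esub>" if x: "x \<in> carrier G" "h x = \<one>\<^bsub>G\<^esub>" for x
  proof (rule ccontr)
    assume "x \<noteq> \<one>\<^bsub>G\<^esub>"
    then obtain J where J: "J \<in> max_lideals G" "x \<notin> J"
      using assms(3) x(1) unfolding semisimple_def by blast
    \<comment> \<open>\<open>?U\<close> is a basic open neighbourhood of \<open>J\<close>, so by
      density it contains an ideal of finite rank; that ideal also omits \<open>x\<close>.\<close>
    let ?U = "max_lideals G - {I \<in> max_lideals G. x \<in> I}"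
    have U: "openin (max_spectrum G) ?U"
      unfolding max_spectrum_def using x(1) by (blast intro: topology_generated_by_Basis)
    then have "J \<in> topspace (max_spectrum G)"
      using J openin_subset by blast
    then have "\<forall>T. J \<in> T \<and> openin (max_spectrum G) T \<longrightarrow>
        (\<exists>I. I \<in> {I \<in> max_lideals G. finite_rank G I} \<and> I \<in> T)"
      using in_closure_of[THEN iffD1, THEN conjunct2, OF equalityD2[OF assms(4), THEN subsetD]]
      by blast
    from this[rule_format, OF conjI, OF _ U] J
    obtain I where "I \<in> max_lideals G" "finite_rank G I" "x \<notin> I"
      by auto
    then obtain v f where f: "f \<in> ulhom G (int_ulgroup v)" "f x \<noteq> 0"
      using finite_rank_separates[OF assms(1) _ _ x(1)] unfolding max_lideals_def by blast
    obtain g where g: "g \<in> ulhom G (int_ulgroup v)" "f x = g (h x)"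
      using ulhom_int_factors[OF assms(1,2) h f(1)] x(1) by blast
    interpret g: group_hom G "int_ulgroup v" g
      by (rule ulhom_group_hom[OF G.is_group int_ulgroup_group g(1)])
    \<comment> \<open>Here \<open>f x = g (h x)\<close> is the value of \<open>g\<close> at zero,
      hence 0.\<close>
    show False
      using f(2) g.hom_one unfolding g(2) x(2) by (simp add: int_ulgroup_def)
  qed
  then have "inj_on h (carrier G)"
    using h.inj_on_one_iff by blast
  then show "h \<in> uliso G G"
    using h by (simp add: uliso_def bij_betw_def)
qed

end
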